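(* Let $0\le c<1$ and let $(p_n)_{n\ge1}$ be a sequence in $[0,1]$ with $p_n=\Omega(n^{-c})$, and for each $n$ let $G_n$ be a random graph drawn from the Erdős–Rényi distribution $G(n,p_n)$. Then for all $\epsilon>0$ and $\delta>0$ there exists $N$ such that for all $n\ge N$, $$P[\mathrm{GAPVS}(G_n)<1+\delta]>1-\epsilon.$$
   Context: $p_n=\Omega(n^{-c})$ means there exist $k>0$ and $n_0$ with $p_n \ge k n^{-c}$ for all $n\ge n_0$. The distribution $G(n,p)$ on graphs with vertex set of size $n$ includes each of the $\binom{n}{2}$ possible edges independently with probability $p$. For an undirected graph $G=(V,E)$ with $|V|=n$, a layout is a bijection $\phi:V\to\{1,\dots,n\}$. For $1\le i\le n$, let $\sigma(i,\phi,G)$ be the number of vertices $u$ with $\phi(u)\le i$ for which there exists $v$ with $\phi(v)>i$ and $uv\in E$. Define $\mathrm{VS}(G,\phi)=\max_{1\le i\le n}\sigma(i,\phi,G)$, $\mathrm{MINVS}(G)=\min_\phi\mathrm{VS}(G,\phi)$, $\mathrm{MAXVS}(G)=\max_\phi\mathrm{VS}(G,\phi)$ over all layouts $\phi$, and $\mathrm{GAPVS}(G)=\mathrm{MAXVS}(G)/\mathrm{MINVS}(G)$. *)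

theory Defs
  imports "HOL-Probability.Probability" "HOL-Probability.Product_PMF"
begin

text \<open>A finite simple graph is given by its vertex set \<open>V\<close> and its edge set \<open>E\<close>, a set of
  two-element subsets of \<open>V\<close>.\<close>

definition all_edges :: "'a set \<Rightarrow> 'a set set" where
  "all_edges V = {e. e \<subseteq> V \<and> card e = 2}"

text \<open>The distribution of the edge set of \<open>G(n,p)\<close> on the vertex set \<open>{1..n}\<close>.\<close>

definition Gnp :: "nat \<Rightarrow> real \<Rightarrow> nat set set pmf" where
  "Gnp n p =
     map_pmf (\<lambda>present. {e \<in> all_edges {1..n}. present e})
       (Pi_pmf (all_edges {1..n}) False (\<lambda>_. bernoulli_pmf p))"

text \<open>Extensionality selects one total function per bijection \<open>V \<rightarrow> {1..card V}\<close>, so that a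
  finite \<open>V\<close> has finitely many layouts.\<close>

definition layouts :: "'a set \<Rightarrow> ('a \<Rightarrow> nat) set" where
  "layouts V = {\<phi> \<in> extensional V. bij_betw \<phi> V {1..card V}}"

definition cut_size :: "nat \<Rightarrow> ('a \<Rightarrow> nat) \<Rightarrow> 'a set \<Rightarrow> 'a set set \<Rightarrow> nat" where
  "cut_size i \<phi> V E = card {u \<in> V. \<phi> u \<le> i \<and> (\<exists>v\<in>V. \<phi> v > i \<and> {u, v} \<in> E)}"

text \<open>The maxima and minima below are meaningful for finite nonempty \<open>V\<close>.\<close>

definition VS :: "'a set \<Rightarrow> 'a set set \<Rightarrow> ('a \<Rightarrow> nat) \<Rightarrow> nat" where
  "VS V E \<phi> = Max ((\<lambda>i. cut_size i \<phi> V E) ` {1..card V})"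

definition MINVS :: "'a set \<Rightarrow> 'a set set \<Rightarrow> nat" where
  "MINVS V E = Min (VS V E ` layouts V)"

definition MAXVS :: "'a set \<Rightarrow> 'a set set \<Rightarrow> nat" where
  "MAXVS V E = Max (VS V E ` layouts V)"

text \<open>The quotient is undefined on edgeless graphs, where both \<open>MINVS\<close> and \<open>MAXVS\<close> are \<open>0\<close>;
  there the totalised division gives the meaningless value \<open>0\<close>.\<close>

definition GAPVS :: "'a set \<Rightarrow> 'a set set \<Rightarrow> real" where
  "GAPVS V E = real (MAXVS V E) / real (MINVS V E)"

end

theory Submission
  imports Defs "HOL-Real_Asymp.Real_Asymp"
begin

text \<open>Always \<open>MAXVS \<le> n\<close>. Conversely, suppose that any two disjoint \<open>m\<close>-sets of vertices are
  joined by an edge, and cut a layout before its last \<open>m\<close> vertices: fewer than \<open>m\<close> of the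
  first \<open>n - m\<close> vertices can lack a neighbour beyond the cut, so \<open>MINVS > n - 2m\<close>.
  By a union bound over at most \<open>4\<^sup>n\<close> pairs of sets, the hypothesis fails in \<open>G(n,p)\<close> with
  probability at most \<open>4\<^sup>n (1-p)\<^bsup>m\<^sup>2\<^esup> \<le> exp (n ln 4 - p m\<^sup>2)\<close>. For \<open>m \<approx> \<theta>n\<close> this tends to \<open>0\<close> as
  soon as \<open>n p \<rightarrow> \<infinity>\<close>, and \<open>n / (n - 2m)\<close> is close to \<open>1\<close> when \<open>\<theta>\<close> is small.\<close>

definition edges_between :: "'a set \<Rightarrow> 'a set \<Rightarrow> 'a set set" where
  "edges_between A B = (\<lambda>(a, b). {a, b}) ` (A \<times> B)"

definition disjoint_pairs :: "nat \<Rightarrow> nat \<Rightarrow> 'a set \<Rightarrow> ('a set \<times> 'a set) set" where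
  "disjoint_pairs s t V =
     {(A, B). A \<subseteq> V \<and> B \<subseteq> V \<and> A \<inter> B = {} \<and> card A = s \<and> card B = t}"

definition bipartite_hole_free :: "nat \<Rightarrow> nat \<Rightarrow> 'a set \<Rightarrow> 'a set set \<Rightarrow> bool" where
  "bipartite_hole_free s t V E \<longleftrightarrow>
     (\<forall>(A, B)\<in>disjoint_pairs s t V. edges_between A B \<inter> E \<noteq> {})"

subsection \<open>Layouts and vertex separation\<close>

lemma finite_layouts:
  assumes "finite V"
  shows "finite (layouts V)"
proof (rule finite_subset)
  show "layouts V \<subseteq> V \<rightarrow>\<^sub>E {1..card V}"
    by (auto simp: layouts_def PiE_def bij_betw_def)
  show "finite (V \<rightarrow>\<^sub>E {1..card V})"
    using assms by (simp add: finite_PiE)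
qed

lemma layouts_nonempty:
  assumes "finite V"
  shows "layouts V \<noteq> {}"
proof -
  obtain h where "bij_betw h V {1..card V}"
    using finite_same_card_bij[OF assms, of "{1..card V}"] by auto
  then have "restrict h V \<in> layouts V"
    by (simp add: layouts_def bij_betw_restrict_eq)
  then show ?thesis by blast
qed

lemma card_layout_vimage:
  assumes "\<phi> \<in> layouts V" and "I \<subseteq> {1..card V}"
  shows "card {u \<in> V. \<phi> u \<in> I} = card I"
proof (rule bij_betw_same_card)
  have bij: "bij_betw \<phi> V {1..card V}"
    using assms(1) by (simp add: layouts_def)
  then have "I \<subseteq> \<phi> ` V"
    using assms(2) by (simp add: bij_betw_def)
  then show "bij_betw \<phi> {u \<in> V. \<phi> u \<in> I} I"
    by (intro bij_betw_subset[OF bij]) auto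
qed

lemma cut_size_le_card:
  assumes "finite V"
  shows "cut_size i \<phi> V E \<le> card V"
  unfolding cut_size_def by (rule card_mono[OF assms]) blast

lemma MAXVS_le_card:
  assumes "finite V" and "V \<noteq> {}"
  shows "MAXVS V E \<le> card V"
proof -
  have "VS V E \<phi> \<le> card V" for \<phi>
    unfolding VS_def using assms cut_size_le_card[OF assms(1)]
    by (intro Max.boundedI) (auto simp: Suc_le_eq card_gt_0_iff)
  then show ?thesis
    unfolding MAXVS_def using finite_layouts[OF assms(1)] layouts_nonempty[OF assms(1)]
    by (intro Max.boundedI) auto
qed

lemma cut_size_le_VS:
  assumes "i \<in> {1..card V}"
  shows "cut_size i \<phi> V E \<le> VS V E \<phi>"
  unfolding VS_def using assms by (intro Max_ge) auto

lemma less_cut_size_if_bipartite_hole_free: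
  assumes \<phi>: "\<phi> \<in> layouts V" and free: "bipartite_hole_free s t V E"
    and i: "i + t \<le> card V"
  shows "i < s + cut_size i \<phi> V E"
proof -
  define F where "F = {u \<in> V. \<phi> u \<in> {1..i}}"
  define B where "B = {u \<in> V. \<phi> u \<in> {i<..i + t}}"
  define C where "C = {u \<in> V. \<phi> u \<le> i \<and> (\<exists>v\<in>V. \<phi> v > i \<and> {u, v} \<in> E)}"
  have bij: "bij_betw \<phi> V {1..card V}"
    using \<phi> by (simp add: layouts_def)
  have fin: "finite V"
    using bij_betw_finite[OF bij] by simp
  have card_F: "card F = i"
    unfolding F_def using i by (subst card_layout_vimage[OF \<phi>]) auto
  have card_B: "card B = t"
    unfolding B_def using i by (subst card_layout_vimage[OF \<phi>]) auto
  have "card (F - C) < s"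
  proof (rule ccontr)
    assume "\<not> card (F - C) < s"
    then obtain A where A: "A \<subseteq> F - C" "card A = s"
      by (meson not_less obtain_subset_with_card_n)
    then have "(A, B) \<in> disjoint_pairs s t V"
      using card_B by (auto simp: disjoint_pairs_def F_def B_def)
    then have "edges_between A B \<inter> E \<noteq> {}"
      using free by (auto simp: bipartite_hole_free_def)
    then obtain a b where "a \<in> A" "b \<in> B" "{a, b} \<in> E"
      by (auto simp: edges_between_def)
    with A show False
      by (auto simp: F_def B_def C_def)
  qed
  moreover have "C \<subseteq> F"
    using bij by (auto simp: C_def F_def bij_betw_def)
  then have "card (F - C) = i - card C"
    using fin card_F by (simp add: card_Diff_subset finite_subset F_def)
  ultimately show ?thesis
    by (simp add: cut_size_def C_def)
qed

lemma less_MINVS_if_bipartite_hole_free: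
  assumes "finite V" and "bipartite_hole_free s t V E" and "t < card V"
  shows "card V < s + t + MINVS V E"
proof -
  have "MINVS V E \<in> VS V E ` layouts V"
    unfolding MINVS_def using finite_layouts[OF assms(1)] layouts_nonempty[OF assms(1)]
    by (intro Min_in) auto
  then obtain \<phi> where \<phi>: "\<phi> \<in> layouts V" "MINVS V E = VS V E \<phi>"
    by blast
  have "card V - t < s + cut_size (card V - t) \<phi> V E"
    using less_cut_size_if_bipartite_hole_free[OF \<phi>(1) assms(2)] assms(3) by simp
  also have "\<dots> \<le> s + MINVS V E"
    using cut_size_le_VS[of "card V - t" V] assms(3) \<phi>(2) by simp
  finally show ?thesis by simp
qed

lemma GAPVS_le_if_bipartite_hole_free:
  assumes "finite V" and "bipartite_hole_free s t V E" and "s + t < card V"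
  shows "GAPVS V E \<le> real (card V) / real (card V - (s + t))"
  unfolding GAPVS_def
proof (rule frac_le)
  show "real (MAXVS V E) \<le> card V"
    using MAXVS_le_card[OF assms(1)] assms(3) by fastforce
  show "real (card V - (s + t)) \<le> MINVS V E"
    using less_MINVS_if_bipartite_hole_free[OF assms(1,2)] assms(3) by simp
qed (use assms(3) in simp_all)

lemma GAPVS_less_if_bipartite_hole_free:
  assumes "finite V" and "bipartite_hole_free s t V E" and "\<delta> > 0"
    and small: "(1 + \<delta>) * real (s + t) < \<delta> * card V"
  shows "MINVS V E \<noteq> 0 \<and> GAPVS V E < 1 + \<delta>"
proof
  have "\<delta> * card V \<le> (1 + \<delta>) * card V"
    by (intro mult_right_mono) simp_all
  with small have "(1 + \<delta>) * real (s + t) < (1 + \<delta>) * card V"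
    by (rule less_le_trans)
  then have st: "s + t < card V"
    using \<open>\<delta> > 0\<close> by (simp del: of_nat_add)
  then show "MINVS V E \<noteq> 0"
    using less_MINVS_if_bipartite_hole_free[OF assms(1,2)] by fastforce
  have "GAPVS V E \<le> real (card V) / real (card V - (s + t))"
    by (rule GAPVS_le_if_bipartite_hole_free[OF assms(1,2) st])
  also have "\<dots> < 1 + \<delta>"
    using small st by (simp add: divide_less_eq of_nat_diff algebra_simps)
  finally show "GAPVS V E < 1 + \<delta>" .
qed

subsection \<open>Bipartite holes in random graphs\<close>

lemma finite_all_edges:
  assumes "finite V"
  shows "finite (all_edges V)"
  by (rule finite_subset[of _ "Pow V"]) (use assms in \<open>auto simp: all_edges_def\<close>)

lemma edges_between_subset_all_edges:
  assumes "A \<subseteq> V" and "B \<subseteq> V" and "A \<inter> B = {}"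
  shows "edges_between A B \<subseteq> all_edges V"
  using assms by (fastforce simp: edges_between_def all_edges_def card_2_iff)

lemma card_edges_between:
  assumes "A \<inter> B = {}"
  shows "card (edges_between A B) = card A * card B"
proof -
  have "inj_on (\<lambda>(a, b). {a, b}) (A \<times> B)"
    using assms by (auto simp: inj_on_def doubleton_eq_iff)
  then show ?thesis
    by (simp add: edges_between_def card_image card_cartesian_product)
qed

lemma disjoint_pairs_subset: "disjoint_pairs s t V \<subseteq> Pow V \<times> Pow V"
  by (auto simp: disjoint_pairs_def)

lemma card_disjoint_pairs_le:
  assumes "finite V"
  shows "card (disjoint_pairs s t V) \<le> 4 ^ card V"
proof -
  have "card (disjoint_pairs s t V) \<le> card (Pow V \<times> Pow V)"
    by (intro card_mono disjoint_pairs_subset) (simp add: assms)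
  also have "\<dots> = 4 ^ card V"
    using assms by (simp add: card_cartesian_product card_Pow flip: power_mult_distrib)
  finally show ?thesis .
qed

lemma prob_Gnp_disjoint:
  assumes "S \<subseteq> all_edges {1..n}" and "0 \<le> p" and "p \<le> 1"
  shows "measure_pmf.prob (Gnp n p) {E. S \<inter> E = {}} = (1 - p) ^ card S"
proof -
  let ?U = "all_edges {1..n}"
  let ?B = "\<lambda>e. if e \<in> S then {False} else UNIV"
  have fin: "finite ?U"
    by (simp add: finite_all_edges)
  have "measure_pmf.prob (Gnp n p) {E. S \<inter> E = {}} =
      measure_pmf.prob (Pi_pmf ?U False (\<lambda>_. bernoulli_pmf p)) (Pi ?U ?B)"
    unfolding Gnp_def measure_map_pmf
    by (rule arg_cong[where f = "measure_pmf.prob _"]) (use assms(1) in \<open>auto simp: Pi_def\<close>)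
  also have "\<dots> = (\<Prod>e\<in>?U. measure_pmf.prob (bernoulli_pmf p) (?B e))"
    by (rule measure_Pi_pmf_Pi[OF fin])
  also have "\<dots> = (\<Prod>e\<in>?U. if e \<in> S then 1 - p else 1)"
    using assms(2,3) by (intro prod.cong) (auto simp: measure_pmf_single)
  also have "\<dots> = (1 - p) ^ card S"
    using assms(1) fin by (simp add: prod.If_cases Int_absorb1)
  finally show ?thesis .
qed

lemma prob_Gnp_not_bipartite_hole_free_le:
  assumes "0 \<le> p" and "p \<le> 1"
  shows "measure_pmf.prob (Gnp n p) {E. \<not> bipartite_hole_free s t {1..n} E} \<le>
    4 ^ n * (1 - p) ^ (s * t)"
proof -
  let ?P = "measure_pmf.prob (Gnp n p)"
  let ?D = "disjoint_pairs s t {1..n}"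
  have fin: "finite ?D"
    by (rule finite_subset[OF disjoint_pairs_subset]) simp
  have "{E. \<not> bipartite_hole_free s t {1..n} E} =
      (\<Union>(A, B)\<in>?D. {E. edges_between A B \<inter> E = {}})"
    by (auto simp: bipartite_hole_free_def)
  then have "?P {E. \<not> bipartite_hole_free s t {1..n} E} \<le>
      (\<Sum>(A, B)\<in>?D. ?P {E. edges_between A B \<inter> E = {}})"
    using measure_pmf.finite_measure_subadditive_finite[OF fin,
        of "\<lambda>(A, B). {E. edges_between A B \<inter> E = {}}" "Gnp n p"]
    by (simp add: case_prod_unfold)
  also have "\<dots> = (\<Sum>_\<in>?D. (1 - p) ^ (s * t))"
    using assms
    by (intro sum.cong)
      (auto simp: disjoint_pairs_def prob_Gnp_disjoint edges_between_subset_all_edges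
        card_edges_between)
  also have "\<dots> = card ?D * (1 - p) ^ (s * t)"
    by simp
  also have "\<dots> \<le> 4 ^ n * (1 - p) ^ (s * t)"
  proof (rule mult_right_mono)
    show "real (card ?D) \<le> 4 ^ n"
      using of_nat_mono[OF card_disjoint_pairs_le[of "{1..n}"], where ?'a = real] by simp
  qed (use assms in simp)
  finally show ?thesis .
qed

lemma prob_Gnp_not_bipartite_hole_free_le_exp:
  assumes "0 \<le> p" and "p \<le> 1"
  shows "measure_pmf.prob (Gnp n p) {E. \<not> bipartite_hole_free s t {1..n} E} \<le>
    exp (n * ln 4 - p * real (s * t))"
proof -
  have "measure_pmf.prob (Gnp n p) {E. \<not> bipartite_hole_free s t {1..n} E} \<le>
      4 ^ n * (1 - p) ^ (s * t)"
    using assms by (rule prob_Gnp_not_bipartite_hole_free_le)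
  also have "\<dots> \<le> 4 ^ n * exp (- p) ^ (s * t)"
    using assms exp_ge_add_one_self[of "- p"] by (intro mult_left_mono power_mono) auto
  also have "\<dots> = exp (n * ln 4) * exp (- (p * real (s * t)))"
    by (simp add: exp_of_nat_mult algebra_simps flip: exp_of_nat_mult[of "s * t"])
  also have "\<dots> = exp (n * ln 4 - p * real (s * t))"
    by (simp flip: exp_add)
  finally show ?thesis .
qed

lemma tendsto_prob_Gnp_not_bipartite_hole_free:
  fixes p :: "nat \<Rightarrow> real"
  assumes p: "\<forall>\<^sub>F n in sequentially. 0 \<le> p n \<and> p n \<le> 1"
    and np: "filterlim (\<lambda>n. n * p n) at_top sequentially"
    and "\<theta> > 0" and st: "\<forall>\<^sub>F n in sequentially. \<theta> * (real n)\<^sup>2 \<le> real (s n * t n)"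
  shows "(\<lambda>n. measure_pmf.prob (Gnp n (p n)) {E. \<not> bipartite_hole_free (s n) (t n) {1..n} E})
    \<longlonglongrightarrow> 0"
proof (rule tendsto_sandwich[where f = "\<lambda>_. 0" and h = "\<lambda>n. exp (- real n)"])
  have "\<forall>\<^sub>F n in sequentially. (ln 4 + 1) / \<theta> \<le> n * p n"
    using np by (simp add: filterlim_at_top)
  with p st show "\<forall>\<^sub>F n in sequentially.
      measure_pmf.prob (Gnp n (p n)) {E. \<not> bipartite_hole_free (s n) (t n) {1..n} E}
      \<le> exp (- real n)"
  proof eventually_elim
    case (elim n)
    have "n * (ln 4 + 1) \<le> n * (\<theta> * (n * p n))"
      using elim(3) \<open>\<theta> > 0\<close> by (intro mult_left_mono) (simp_all add: field_simps)
    also have "\<dots> = p n * (\<theta> * (real n)\<^sup>2)"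
      by (simp add: power2_eq_square)
    also have "\<dots> \<le> p n * real (s n * t n)"
      using elim(1,2) by (intro mult_left_mono) simp_all
    finally have "exp (n * ln 4 - p n * real (s n * t n)) \<le> exp (- real n)"
      by (simp add: algebra_simps)
    then show ?case
      using prob_Gnp_not_bipartite_hole_free_le_exp elim(1) order_trans by blast
  qed
  show "(\<lambda>n. exp (- real n)) \<longlonglongrightarrow> 0"
    by real_asymp
qed simp_all

lemma tendsto_prob_Gnp_bipartite_hole_free:
  fixes p :: "nat \<Rightarrow> real"
  assumes "\<forall>\<^sub>F n in sequentially. 0 \<le> p n \<and> p n \<le> 1"
    and "filterlim (\<lambda>n. n * p n) at_top sequentially"
    and "\<theta> > 0" and "\<forall>\<^sub>F n in sequentially. \<theta> * (real n)\<^sup>2 \<le> real (s n * t n)"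
  shows "(\<lambda>n. measure_pmf.prob (Gnp n (p n)) {E. bipartite_hole_free (s n) (t n) {1..n} E})
    \<longlonglongrightarrow> 1"
proof -
  have "measure_pmf.prob (Gnp n (p n)) {E. bipartite_hole_free (s n) (t n) {1..n} E} =
      1 - measure_pmf.prob (Gnp n (p n)) {E. \<not> bipartite_hole_free (s n) (t n) {1..n} E}" for n
    using measure_pmf.prob_neg[where M = "Gnp n (p n)"] by simp
  then show ?thesis
    using tendsto_diff[OF tendsto_const[of 1] tendsto_prob_Gnp_not_bipartite_hole_free[OF assms]]
    by simp
qed

subsection \<open>The vertex separation gap of random graphs\<close>

lemma tendsto_prob_Gnp_GAPVS_less:
  fixes p :: "nat \<Rightarrow> real"
  assumes p: "\<forall>\<^sub>F n in sequentially. 0 \<le> p n \<and> p n \<le> 1"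
    and np: "filterlim (\<lambda>n. n * p n) at_top sequentially" and "\<delta> > 0"
  shows "(\<lambda>n. measure_pmf.prob (Gnp n (p n))
    {E. MINVS {1..n} E \<noteq> 0 \<and> GAPVS {1..n} E < 1 + \<delta>}) \<longlonglongrightarrow> 1"
proof (rule tendsto_sandwich[where h = "\<lambda>_. 1"])
  define \<theta> where "\<theta> = \<delta> / (4 * (1 + \<delta>))"
  define m where "m n = nat \<lceil>\<theta> * real n\<rceil>" for n
  have "\<theta> > 0"
    using \<open>\<delta> > 0\<close> by (simp add: \<theta>_def)
  have "\<theta>\<^sup>2 * (real n)\<^sup>2 \<le> real (m n * m n)" for n
  proof -
    have "\<theta> * n \<le> m n"
      unfolding m_def by (rule real_nat_ceiling_ge)
    then have "(\<theta> * n)\<^sup>2 \<le> (real (m n))\<^sup>2"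
      using \<open>\<theta> > 0\<close> by (intro power_mono) simp_all
    then show ?thesis
      by (simp add: power_mult_distrib flip: power2_eq_square)
  qed
  then show "(\<lambda>n. measure_pmf.prob (Gnp n (p n))
      {E. bipartite_hole_free (m n) (m n) {1..n} E}) \<longlonglongrightarrow> 1"
    using \<open>\<theta> > 0\<close> by (intro tendsto_prob_Gnp_bipartite_hole_free[OF p np, of "\<theta>\<^sup>2"]) auto
  have "\<forall>\<^sub>F n in sequentially. 1 / \<theta> < real n"
    using filterlim_real_sequentially by (simp add: filterlim_at_top_dense)
  then show "\<forall>\<^sub>F n in sequentially.
      measure_pmf.prob (Gnp n (p n)) {E. bipartite_hole_free (m n) (m n) {1..n} E}
      \<le> measure_pmf.prob (Gnp n (p n)) {E. MINVS {1..n} E \<noteq> 0 \<and> GAPVS {1..n} E < 1 + \<delta>}"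
  proof eventually_elim
    case (elim n)
    have "real (m n) \<le> \<theta> * n + 1"
      using \<open>\<theta> > 0\<close> by (simp add: m_def)
    also have "\<dots> < 2 * \<theta> * n"
      using elim \<open>\<theta> > 0\<close> by (simp add: field_simps)
    finally have "(1 + \<delta>) * real (m n + m n) < (1 + \<delta>) * (4 * \<theta> * n)"
      using \<open>\<delta> > 0\<close> by simp
    also have "\<dots> = \<delta> * card {1..n}"
      using \<open>\<delta> > 0\<close> by (simp add: \<theta>_def field_simps)
    finally have m_less: "(1 + \<delta>) * real (m n + m n) < \<delta> * card {1..n}" .
    show ?case
      by (intro measure_pmf.finite_measure_mono)
        (use GAPVS_less_if_bipartite_hole_free[OF _ _ \<open>\<delta> > 0\<close> m_less] in auto)
  qed
qed simp_all

theorem theorem5: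
  fixes c :: real and p :: "nat \<Rightarrow> real"
  assumes "0 \<le> c" and "c < 1"
    and "\<And>n. n \<ge> 1 \<Longrightarrow> 0 \<le> p n \<and> p n \<le> 1"
    and "\<exists>k>0. \<exists>n\<^sub>0. \<forall>n\<ge>n\<^sub>0. p n \<ge> k * real n powr (- c)"
  shows "\<forall>\<epsilon>>0. \<forall>\<delta>>0. \<exists>N. \<forall>n\<ge>N.
    measure_pmf.prob (Gnp n (p n))
      {E. MINVS {1..n} E \<noteq> 0 \<and> GAPVS {1..n} E < 1 + \<delta>} > 1 - \<epsilon>"
proof (intro allI impI)
  fix \<epsilon> \<delta> :: real
  assume "\<epsilon> > 0" and "\<delta> > 0"
  obtain k where "k > 0" and p_ge: "\<forall>\<^sub>F n in sequentially. k * real n powr (- c) \<le> p n"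
    using assms(4) unfolding eventually_sequentially by blast
  have "filterlim (\<lambda>n. real n * (k * real n powr (- c))) at_top sequentially"
    using \<open>k > 0\<close> \<open>c < 1\<close> by real_asymp
  moreover have "\<forall>\<^sub>F n in sequentially. real n * (k * real n powr (- c)) \<le> n * p n"
    using p_ge by eventually_elim (simp add: mult_left_mono)
  ultimately have np: "filterlim (\<lambda>n. n * p n) at_top sequentially"
    by (rule filterlim_at_top_mono)
  have "\<forall>\<^sub>F n in sequentially. 0 \<le> p n \<and> p n \<le> 1"
    using assms(3) unfolding eventually_sequentially by blast
  then have "(\<lambda>n. measure_pmf.prob (Gnp n (p n))
      {E. MINVS {1..n} E \<noteq> 0 \<and> GAPVS {1..n} E < 1 + \<delta>}) \<longlonglongrightarrow> 1"
    using np \<open>\<delta> > 0\<close> by (rule tendsto_prob_Gnp_GAPVS_less)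
  then show "\<exists>N. \<forall>n\<ge>N. measure_pmf.prob (Gnp n (p n))
      {E. MINVS {1..n} E \<noteq> 0 \<and> GAPVS {1..n} E < 1 + \<delta>} > 1 - \<epsilon>"
    unfolding eventually_sequentially[symmetric]
    by (rule order_tendstoD) (simp add: \<open>\<epsilon> > 0\<close>)
qed

end
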